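(* Let $g\in\mathcal{S}(\mathbb{R})\setminus\{0\}$ and let $$|||f||| := \|\{\langle f, g_{n,k}\rangle\}\|_{\ell_w^p}^p = \sum_{n,k\in\mathbb{Z}} |\langle f, g_{n,k}\rangle|^p\, w(n x_0, k y_0)^p$$ with $s\geq 0$ and $p\in[1,2]$. Then, for every $m\in\mathbb{N}$ with $m>sp+1$, there exists a constant $C_{m,x_0,y_0}>0$ that depends on only $m$, $x_0$ and $y_0$, such that $$\Big|\, |||f_a^+||| - |||f_a^-||| \,\Big| \leq C_{m,x_0,y_0}\,(1+a)^{sp-m+1}.$$
   Context: $\mathcal{S}(\mathbb{R})$ is the Schwartz space. For parameters $x_0,y_0>0$ set $g_{n,k}(t)=e^{2\pi i k y_0 t}g(t-n x_0)$ for $n,k\in\mathbb{Z}$; $\langle\cdot,\cdot\rangle$ is the $L^2(\mathbb{R})$ inner product. The weight is $w(x,y)=\big((1+|x|)(1+|y|)\big)^s$. Let $\varphi(t)=e^{-\pi t^2}$ and, for a positive parameter $a$, let $f_a^+(t)=\varphi(t+a)+\varphi(t-a)$ and $f_a^-(t)=\varphi(t+a)-\varphi(t-a)$.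
   Formalization: The constant may also depend on the window g, besides m, x_0 and y_0 (it is uniform in s, p and a); independence of g is impossible, since replacing g by λg multiplies the left side by |λ|^p. *)

theory Defs
  imports "HOL-Analysis.Analysis"
begin

definition higher_vderiv :: "nat \<Rightarrow> (real \<Rightarrow> complex) \<Rightarrow> real \<Rightarrow> complex" where
  "higher_vderiv k f = ((\<lambda>h t. vector_derivative h (at t)) ^^ k) f"

(* The first conjunct is needed because vector_derivative is total: it says that
   every iterated derivative genuinely exists, i.e. f is C^infinity. *)
definition schwartz_space :: "(real \<Rightarrow> complex) set" where
  "schwartz_space =
     {f. (\<forall>k t. higher_vderiv k f differentiable (at t)) \<and>
         (\<forall>j k. bounded (range (\<lambda>t. t ^ j *\<^sub>R higher_vderiv k f t)))}"

definition L2_inner :: "(real \<Rightarrow> complex) \<Rightarrow> (real \<Rightarrow> complex) \<Rightarrow> complex" where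
  "L2_inner f h = (LINT t|lborel. f t * cnj (h t))"

definition gabor_atom ::
    "real \<Rightarrow> real \<Rightarrow> (real \<Rightarrow> complex) \<Rightarrow> int \<Rightarrow> int \<Rightarrow> real \<Rightarrow> complex" where
  "gabor_atom x0 y0 g n k t =
     exp (2 * of_real pi * \<i> * of_int k * of_real y0 * of_real t) * g (t - of_int n * x0)"

definition weight :: "real \<Rightarrow> real \<Rightarrow> real \<Rightarrow> real" where
  "weight s x y = ((1 + \<bar>x\<bar>) * (1 + \<bar>y\<bar>)) powr s"

definition gabor_term ::
    "real \<Rightarrow> real \<Rightarrow> (real \<Rightarrow> complex) \<Rightarrow> real \<Rightarrow> real \<Rightarrow> (real \<Rightarrow> complex) \<Rightarrow> int \<times> int \<Rightarrow> real" where
  "gabor_term x0 y0 g s p f = (\<lambda>(n, k).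
     cmod (L2_inner f (gabor_atom x0 y0 g n k)) powr p
       * weight s (of_int n * x0) (of_int k * y0) powr p)"

(* The p-th power of the weighted l^p norm of the Gabor coefficients. As a real infsum it is 0
   when the series diverges, so it has its intended meaning only for summable gabor_term. *)
definition gabor_norm_pow ::
    "real \<Rightarrow> real \<Rightarrow> (real \<Rightarrow> complex) \<Rightarrow> real \<Rightarrow> real \<Rightarrow> (real \<Rightarrow> complex) \<Rightarrow> real" where
  "gabor_norm_pow x0 y0 g s p f = (\<Sum>\<^sub>\<infinity>z\<in>UNIV. gabor_term x0 y0 g s p f z)"

definition gaussian :: "real \<Rightarrow> complex" where
  "gaussian t = of_real (exp (- pi * t\<^sup>2))"

definition f_plus :: "real \<Rightarrow> real \<Rightarrow> complex" where
  "f_plus a t = gaussian (t + a) + gaussian (t - a)"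

definition f_minus :: "real \<Rightarrow> real \<Rightarrow> complex" where
  "f_minus a t = gaussian (t + a) - gaussian (t - a)"

end

theory Submission
  imports Defs "HOL-Probability.Sinc_Integral"
begin

text \<open>
  The Gabor coefficients of \<^term>\<open>f_plus a\<close> and \<^term>\<open>f_minus a\<close> are $A + B$ and $A - B$, where $A$ and
  $B$ are the coefficients of the two Gaussian bumps centred at $-a$ and $a$. Only the interference
  of $A$ with $B$ can make $|A + B|^p$ and $|A - B|^p$ differ: by the mean value theorem, for
  $1 \le p \le 2$ and $|A|, |B| \le K$ with $K \ge 1$, the difference is at most
  $8 K \min(|A|, |B|)$ (\<open>cmod_sum_diff_powr\<close>).

  The short-time Fourier transform of one Schwartz function with respect to another decays faster
  than any power, in the distance of their centres and in the frequency (\<open>stft_decay\<close>); this is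
  repeated integration by parts. At a lattice point with time coordinate $x$ and frequency
  coordinate $y$, the smaller of $|A|$ and $|B|$ belongs to the bump that is farther from $x$, and
  its distance from $x$ is $\max(|x - a|, |x + a|) = |x| + a$. With the decay exponent $m + 1$,
  \[ \min(|A|, |B|) \le K\,(1 + |x| + a)^{-(m+1)} (1 + |y|)^{-(m+1)} . \]
  Write $r = sp < m - 1$. The $x$-part of the weight is at most $(1 + |x| + a)^r$. Of the
  remaining negative power, $(1 + |x| + a)^{r - m + 1} \le (1 + a)^{r - m + 1}$ is the claimed rate
  and $(1 + |x| + a)^{-2} \le (1 + |x|)^{-2}$ is summable over the lattice; in $y$ there remains
  $(1 + |y|)^{r - m - 1} \le (1 + |y|)^{-2}$. Neither $K$ nor the lattice sum depends on $s$, $p$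
  or $a$, so the constant is uniform in these.
\<close>

section \<open>Decay of Schwartz functions\<close>

lemma higher_vderiv_Suc:
  "higher_vderiv (Suc k) f = (\<lambda>t. vector_derivative (higher_vderiv k f) (at t))"
  by (simp add: higher_vderiv_def)

lemma schwartz_has_vector_derivative:
  assumes "f \<in> schwartz_space"
  shows "(higher_vderiv k f has_vector_derivative higher_vderiv (Suc k) f t) (at t)"
  using assms unfolding schwartz_space_def higher_vderiv_Suc
  by (simp add: vector_derivative_works)

lemma schwartz_continuous_on:
  assumes "f \<in> schwartz_space"
  shows "continuous_on A (higher_vderiv k f)"
  by (meson assms continuous_at_imp_continuous_on has_vector_derivative_continuous
      schwartz_has_vector_derivative)

text \<open>Submultiplicativity of $1 + |\cdot|$ is what lets decay in $t - b$ and in $t - x$ be traded for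
  decay in $x - b$.\<close>
lemma one_plus_abs_add_le: "1 + \<bar>u + v\<bar> \<le> (1 + \<bar>u\<bar>) * (1 + \<bar>v :: real\<bar>)"
proof -
  have "1 + \<bar>u + v\<bar> \<le> 1 + \<bar>u\<bar> + \<bar>v\<bar>" by simp
  also have "\<dots> \<le> 1 + \<bar>u\<bar> + \<bar>v\<bar> + \<bar>u\<bar> * \<bar>v\<bar>" by simp
  finally show ?thesis by (simp add: algebra_simps)
qed

text \<open>Bounds on the two moments of orders $0$ and $N$ thereby give decay of order $N$.\<close>
lemma one_plus_power_le:
  fixes w :: real
  assumes "0 \<le> w"
  shows "(1 + w) ^ N \<le> 2 ^ N * (1 + w ^ N)"
proof -
  have "(1 + w) ^ N \<le> (2 * max 1 w) ^ N"
    using assms by (intro power_mono) auto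
  also have "\<dots> = 2 ^ N * max 1 w ^ N"
    by (rule power_mult_distrib)
  also have "\<dots> \<le> 2 ^ N * (1 + w ^ N)"
    using assms by (intro mult_left_mono) (auto simp: max_def)
  finally show ?thesis .
qed

lemma schwartz_decay:
  assumes "f \<in> schwartz_space"
  obtains C where "0 \<le> C" "\<And>t. cmod (higher_vderiv k f t) * (1 + \<bar>t\<bar>) ^ N \<le> C"
proof -
  have "\<exists>C. \<forall>t. \<bar>t\<bar> ^ j * cmod (higher_vderiv k f t) \<le> C" for j
    using assms unfolding schwartz_space_def bounded_iff by (auto simp: power_abs)
  then obtain B where B: "\<And>j t. \<bar>t\<bar> ^ j * cmod (higher_vderiv k f t) \<le> B j"
    by metis
  have "cmod (higher_vderiv k f t) * (1 + \<bar>t\<bar>) ^ N \<le> 2 ^ N * (B 0 + B N)" for t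
  proof -
    have "cmod (higher_vderiv k f t) * (1 + \<bar>t\<bar>) ^ N
        \<le> cmod (higher_vderiv k f t) * (2 ^ N * (1 + \<bar>t\<bar> ^ N))"
      by (intro mult_left_mono one_plus_power_le) auto
    also have "\<dots> = 2 ^ N * (\<bar>t\<bar> ^ 0 * cmod (higher_vderiv k f t) + \<bar>t\<bar> ^ N * cmod (higher_vderiv k f t))"
      by (simp add: algebra_simps)
    also have "\<dots> \<le> 2 ^ N * (B 0 + B N)"
      by (intro mult_left_mono add_mono B) auto
    finally show ?thesis .
  qed
  moreover have "0 \<le> 2 ^ N * (B 0 + B N)"
    by (rule order.trans[OF _ calculation[of 0]]) simp
  ultimately show thesis using that by blast
qed

text \<open>The exponential series gives $t^{2j} \le j!\, e^{t^2}$, and $|t|^j \le 1 + t^{2j}$ removes the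
  restriction to even powers.\<close>
lemma power_times_gaussian_bounded:
  fixes t :: real
  shows "\<bar>t\<bar> ^ j * exp (- pi * t\<^sup>2) \<le> 1 + fact j"
proof -
  have le1: "t\<^sup>2 \<le> pi * t\<^sup>2"
    using pi_ge_two mult_right_mono[of 1 pi "t\<^sup>2"] by simp
  have "(t\<^sup>2) ^ j /\<^sub>R fact j \<le> (\<Sum>n. (t\<^sup>2) ^ n /\<^sub>R fact n)"
    using sum_le_suminf[OF summable_exp_generic[of "t\<^sup>2"], of "{j}"] by simp
  then have "(t\<^sup>2) ^ j \<le> fact j * exp (t\<^sup>2)"
    by (simp add: exp_def field_simps)
  also have "\<dots> \<le> fact j * exp (pi * t\<^sup>2)"
    using le1 by simp
  finally have 1: "(t\<^sup>2) ^ j \<le> fact j * exp (pi * t\<^sup>2)" .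
  have "\<bar>t\<bar> ^ j \<le> 1 + (\<bar>t\<bar> ^ j)\<^sup>2"
    using sum_squares_bound[of 1 "\<bar>t\<bar> ^ j"] zero_le_power[of "\<bar>t\<bar>" j] by (simp; linarith)
  also have "(\<bar>t\<bar> ^ j)\<^sup>2 = (t\<^sup>2) ^ j"
    by (metis power_mult mult.commute power2_abs)
  also have "1 + (t\<^sup>2) ^ j \<le> exp (pi * t\<^sup>2) + fact j * exp (pi * t\<^sup>2)"
    using 1 by (intro add_mono) auto
  finally show ?thesis by (simp add: exp_minus field_simps)
qed

text \<open>Polynomial multiples of the Gaussian are closed under differentiation, and each of them stays
  bounded when multiplied by a power of $t$.\<close>
lemma gaussian_schwartz: "gaussian \<in> schwartz_space"
proof -
  define P where "P = (\<lambda>p t. of_real (poly p t * exp (- pi * t\<^sup>2)) :: complex)"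
  have der: "(P p has_vector_derivative P (pderiv p - [:0, 2 * pi:] * p) t) (at t)" for p t
    unfolding P_def
    by (rule has_vector_derivative_of_real)
       (auto intro!: derivative_eq_intros simp: has_real_derivative_iff_has_vector_derivative[symmetric] algebra_simps)
  have ex: "\<exists>p. higher_vderiv k gaussian = P p" for k
  proof (induction k)
    case 0
    have "higher_vderiv 0 gaussian = P 1"
      by (simp add: higher_vderiv_def P_def gaussian_def fun_eq_iff)
    then show ?case by blast
  next
    case (Suc k)
    then show ?case
      using der vector_derivative_at by (metis (no_types) higher_vderiv_Suc ext)
  qed
  have bdd: "bounded (range (\<lambda>t. t ^ j *\<^sub>R P p t))" for j p
  proof (induction p arbitrary: j)
    case 0
    then show ?case by (simp add: P_def)
  next
    case (pCons a p)
    have "t ^ j *\<^sub>R P (pCons a p) t = (t ^ j * exp (- pi * t\<^sup>2)) *\<^sub>R of_real a + t ^ Suc j *\<^sub>R P p t" for t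
      by (simp add: P_def scaleR_conv_of_real algebra_simps)
    moreover have "bounded (range (\<lambda>t. (t ^ j * exp (- pi * t\<^sup>2)) *\<^sub>R (of_real a :: complex)))"
      unfolding bounded_iff using power_times_gaussian_bounded[of _ j]
      by (intro exI[of _ "(1 + fact j) * \<bar>a\<bar>"]) (auto simp: abs_mult power_abs intro!: mult_right_mono)
    ultimately show ?case
      using bounded_plus_comp[OF _ pCons(2)[of "Suc j"]] by simp
  qed
  have "higher_vderiv k gaussian differentiable (at t)" for k t
    using ex[of k] der differentiableI_vector by metis
  moreover have "bounded (range (\<lambda>t. t ^ j *\<^sub>R higher_vderiv k gaussian t))" for j k
    using ex[of k] bdd[of j] by auto
  ultimately show ?thesis
    by (simp add: schwartz_space_def)
qed

section \<open>Decay of the short-time Fourier transform\<close>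

text \<open>The majorant is a multiple of the Cauchy density, whose total mass does not depend on the
  centre; so the bound is uniform in $b$.\<close>
lemma integral_norm_bound_by_cauchy_density:
  fixes h :: "real \<Rightarrow> complex"
  assumes "continuous_on UNIV h" and "\<And>t. cmod (h t) \<le> C / (1 + (t - b)\<^sup>2)"
  shows "integrable lborel h" and "cmod (LINT t|lborel. h t) \<le> C * pi"
proof -
  have 1: "integrable lborel (\<lambda>t::real. inverse (1 + t\<^sup>2))"
    using integrable_inverse_1_plus_square by (simp add: set_integrable_def)
  have 2: "(LINT t::real|lborel. inverse (1 + t\<^sup>2)) = pi"
    using LBINT_inverse_1_plus_square
    by (simp add: interval_lebesgue_integral_def set_lebesgue_integral_def)
  have int: "integrable lborel (\<lambda>t. C / (1 + (t - b)\<^sup>2))"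
    using lborel_integrable_real_affine[OF integrable_mult_right[OF 1, of C], of 1 "-b"]
    by (simp add: field_simps)
  have "(LINT t|lborel. C / (1 + (t - b)\<^sup>2)) = (LINT t|lborel. C * inverse (1 + t\<^sup>2))"
    using lborel_integral_real_affine[of 1 "\<lambda>t. C * inverse (1 + t\<^sup>2)" "-b"]
    by (auto simp: divide_inverse)
  also have "\<dots> = C * pi"
    by (simp only: integral_mult_right_zero 2)
  finally have eq: "(LINT t|lborel. C / (1 + (t - b)\<^sup>2)) = C * pi" .
  show "integrable lborel h"
  proof (rule Bochner_Integration.integrable_bound[OF int])
    show "h \<in> borel_measurable lborel"
      using borel_measurable_continuous_onI[OF assms(1)] by simp
    show "AE t in lborel. norm (h t) \<le> norm (C / (1 + (t - b)\<^sup>2))"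
      by (intro AE_I2 order.trans[OF assms(2)]) (simp add: divide_right_mono)
  qed
  then show "cmod (LINT t|lborel. h t) \<le> C * pi"
    using Bochner_Integration.integral_norm_bound_integral[OF _ int, of h] assms(2) eq by simp
qed

lemma integral_derivative_eq_0:
  fixes F f :: "real \<Rightarrow> complex"
  assumes F: "\<And>t. (F has_vector_derivative f t) (at t)" and f: "continuous_on UNIV f"
    and int: "integrable lborel f" and bd: "\<And>t. cmod (F t) \<le> C / (1 + (t - b)\<^sup>2)"
  shows "(LINT t|lborel. f t) = 0"
proof -
  have top: "(F \<longlongrightarrow> 0) at_top"
    by (rule Lim_null_comparison[OF always_eventually[OF allI[OF bd]]]) real_asymp
  have bot: "(F \<longlongrightarrow> 0) at_bot"
    by (rule Lim_null_comparison[OF always_eventually[OF allI[OF bd]]]) real_asymp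
  have "(LBINT t=-\<infinity>..\<infinity>. f t) = 0 - 0"
    by (rule interval_integral_FTC_integrable[where F = F])
       (use F f int top bot in \<open>auto simp: ereal_tendsto_simps set_integrable_def
          continuous_on_eq_continuous_at\<close>)
  then show ?thesis
    by (simp add: interval_lebesgue_integral_def set_lebesgue_integral_def)
qed

text \<open>At $k = l = 0$ this is the integrand of the short-time Fourier transform of $f(\cdot - b)$ with
  window $g$, at time $x$ and angular frequency $\omega$. Derivatives of both factors are carried
  along because integration by parts produces them.\<close>
definition stft_integrand ::
  "(real \<Rightarrow> complex) \<Rightarrow> (real \<Rightarrow> complex) \<Rightarrow> nat \<Rightarrow> nat \<Rightarrow> real \<Rightarrow> real \<Rightarrow> real \<Rightarrow> real \<Rightarrow> complex"
where
  "stft_integrand f g k l b x \<omega> t =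
     higher_vderiv k f (t - b) * cnj (higher_vderiv l g (t - x)) * exp (- (\<i> * of_real \<omega> * of_real t))"

lemma stft_integrand_continuous:
  assumes "f \<in> schwartz_space" "g \<in> schwartz_space"
  shows "continuous_on UNIV (stft_integrand f g k l b x \<omega>)"
proof -
  have "continuous_on UNIV (\<lambda>t. higher_vderiv k h (t - c))" if "h \<in> schwartz_space" for k h c
    by (rule continuous_on_compose2[OF schwartz_continuous_on[OF that, of UNIV]])
       (auto intro!: continuous_intros)
  then show ?thesis
    using assms unfolding stft_integrand_def [abs_def] by (auto intro!: continuous_intros)
qed

lemma stft_integrand_derivative:
  assumes "f \<in> schwartz_space" "g \<in> schwartz_space"
  shows "(stft_integrand f g k l b x \<omega> has_vector_derivative
     stft_integrand f g (Suc k) l b x \<omega> t + stft_integrand f g k (Suc l) b x \<omega> t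
     - \<i> * of_real \<omega> * stft_integrand f g k l b x \<omega> t) (at t)"
proof -
  have sh: "((\<lambda>t. higher_vderiv k h (t - c)) has_vector_derivative higher_vderiv (Suc k) h (t - c)) (at t)"
    if "h \<in> schwartz_space" for k h c
  proof -
    have "((\<lambda>t. t - c) has_vector_derivative 1) (at t)"
      by (auto intro!: derivative_eq_intros)
    from vector_diff_chain_at[OF this schwartz_has_vector_derivative[OF that]] show ?thesis
      by (simp add: o_def)
  qed
  have e: "((\<lambda>t. exp (- (\<i> * of_real \<omega> * of_real t))) has_vector_derivative
      - (\<i> * of_real \<omega>) * exp (- (\<i> * of_real \<omega> * of_real t))) (at t)"
    by (rule has_vector_derivative_real_field) (auto intro!: derivative_eq_intros)
  show ?thesis
    unfolding stft_integrand_def [abs_def]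
    by (rule has_vector_derivative_eq_rhs[OF has_vector_derivative_mult[OF
          has_vector_derivative_mult[OF sh has_vector_derivative_cnj[OF sh]] e]])
       (use assms in \<open>auto simp: algebra_simps\<close>)
qed

text \<open>Of the decay of $f$, two powers are kept to make the integral converge; the rest combines with
  the decay of $g$ into decay in the distance of the two centres.\<close>
lemma stft_integrand_bound:
  assumes "f \<in> schwartz_space" "g \<in> schwartz_space"
  obtains C where "0 \<le> C"
    "\<And>b x \<omega> t. cmod (stft_integrand f g k l b x \<omega> t) \<le> (C / (1 + \<bar>x - b\<bar>) ^ N) / (1 + (t - b)\<^sup>2)"
proof -
  obtain C1 where C1: "0 \<le> C1" "\<And>t. cmod (higher_vderiv k f t) * (1 + \<bar>t\<bar>) ^ (N + 2) \<le> C1"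
    using schwartz_decay[OF assms(1)] by blast
  obtain C2 where C2: "0 \<le> C2" "\<And>t. cmod (higher_vderiv l g t) * (1 + \<bar>t\<bar>) ^ N \<le> C2"
    using schwartz_decay[OF assms(2)] by blast
  show thesis
  proof (rule that[of "C1 * C2"])
    fix b x \<omega> t :: real
    have tri: "1 + \<bar>x - b\<bar> \<le> (1 + \<bar>t - b\<bar>) * (1 + \<bar>t - x\<bar>)"
      using one_plus_abs_add_le[of "t - b" "x - t"] by (simp add: abs_minus_commute)
    have sq: "1 + (t - b)\<^sup>2 \<le> (1 + \<bar>t - b\<bar>)\<^sup>2"
      by (simp add: power2_eq_square algebra_simps)
    let ?u = "cmod (higher_vderiv k f (t - b))" and ?v = "cmod (higher_vderiv l g (t - x))"
    have "?u * ?v * ((1 + \<bar>x - b\<bar>) ^ N * (1 + (t - b)\<^sup>2))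
       \<le> ?u * ?v * (((1 + \<bar>t - b\<bar>) * (1 + \<bar>t - x\<bar>)) ^ N * (1 + \<bar>t - b\<bar>)\<^sup>2)"
      using tri sq by (intro mult_left_mono mult_mono power_mono) auto
    also have "\<dots> = (?u * (1 + \<bar>t - b\<bar>) ^ (N + 2)) * (?v * (1 + \<bar>t - x\<bar>) ^ N)"
      by (simp add: power_mult_distrib power_add power2_eq_square mult_ac)
    also have "\<dots> \<le> C1 * C2"
      using C1 C2 by (intro mult_mono) auto
    finally have "?u * ?v \<le> C1 * C2 / ((1 + \<bar>x - b\<bar>) ^ N * (1 + (t - b)\<^sup>2))"
      by (subst pos_le_divide_eq) (auto intro!: mult_pos_pos add_pos_nonneg)
    moreover have "cmod (stft_integrand f g k l b x \<omega> t) = ?u * ?v"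
      by (simp add: stft_integrand_def norm_mult)
    ultimately show "cmod (stft_integrand f g k l b x \<omega> t)
        \<le> (C1 * C2 / (1 + \<bar>x - b\<bar>) ^ N) / (1 + (t - b)\<^sup>2)"
      by simp
  qed (use C1 C2 in auto)
qed

lemma stft_integrable:
  assumes "f \<in> schwartz_space" "g \<in> schwartz_space"
  shows "integrable lborel (stft_integrand f g k l b x \<omega>)"
proof -
  obtain C where "\<And>b x \<omega> t. cmod (stft_integrand f g k l b x \<omega> t) \<le> (C / (1 + \<bar>x - b\<bar>) ^ 0) / (1 + (t - b)\<^sup>2)"
    using stft_integrand_bound[OF assms] by metis
  then show ?thesis
    by (intro integral_norm_bound_by_cauchy_density(1)[OF stft_integrand_continuous[OF assms]])
qed

text \<open>The derivative of the integrand has integral $0$, and differentiating the exponential produces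
  the factor $\omega$.\<close>
lemma stft_by_parts:
  assumes "f \<in> schwartz_space" "g \<in> schwartz_space"
  shows "\<i> * of_real \<omega> * (LINT t|lborel. stft_integrand f g k l b x \<omega> t) =
     (LINT t|lborel. stft_integrand f g (Suc k) l b x \<omega> t) +
     (LINT t|lborel. stft_integrand f g k (Suc l) b x \<omega> t)"
proof -
  let ?I = "\<lambda>k l. stft_integrand f g k l b x \<omega>"
  note int [simp] = stft_integrable[OF assms]
  obtain C where C: "\<And>b x \<omega> t. cmod (stft_integrand f g k l b x \<omega> t) \<le> (C / (1 + \<bar>x - b\<bar>) ^ 0) / (1 + (t - b)\<^sup>2)"
    using stft_integrand_bound[OF assms] by metis
  have "(LINT t|lborel. ?I (Suc k) l t + ?I k (Suc l) t - \<i> * of_real \<omega> * ?I k l t) = 0"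
    by (rule integral_derivative_eq_0[OF stft_integrand_derivative[OF assms] _ _ C])
       (use assms in \<open>auto intro!: continuous_intros stft_integrand_continuous\<close>)
  then show ?thesis by simp
qed

text \<open>Each integration by parts trades one factor $\omega$ for a derivative of $f$ or of $g$, so the
  induction on $j$ has to range over all orders of derivatives.\<close>
lemma stft_moment_bound:
  assumes "f \<in> schwartz_space" "g \<in> schwartz_space"
  shows "\<exists>C\<ge>0. \<forall>b x \<omega>. \<bar>\<omega>\<bar> ^ j * cmod (LINT t|lborel. stft_integrand f g k l b x \<omega> t) \<le> C / (1 + \<bar>x - b\<bar>) ^ N"
proof (induction j arbitrary: k l)
  case 0
  obtain C where C: "0 \<le> C" 
    "\<And>b x \<omega> t. cmod (stft_integrand f g k l b x \<omega> t) \<le> (C / (1 + \<bar>x - b\<bar>) ^ N) / (1 + (t - b)\<^sup>2)"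
    using stft_integrand_bound[OF assms] by metis
  have "cmod (LINT t|lborel. stft_integrand f g k l b x \<omega> t) \<le> C / (1 + \<bar>x - b\<bar>) ^ N * pi" for b x \<omega>
    by (rule integral_norm_bound_by_cauchy_density(2)[OF stft_integrand_continuous[OF assms] C(2)])
  with C(1) show ?case by (intro exI[of _ "C * pi"]) auto
next
  case (Suc j)
  let ?V = "\<lambda>k l b x \<omega>. LINT t|lborel. stft_integrand f g k l b x \<omega> t"
  obtain C1 where C1: "C1 \<ge> 0" "\<And>b x \<omega>. \<bar>\<omega>\<bar> ^ j * cmod (?V (Suc k) l b x \<omega>) \<le> C1 / (1 + \<bar>x - b\<bar>) ^ N"
    using Suc.IH by meson
  obtain C2 where C2: "C2 \<ge> 0" "\<And>b x \<omega>. \<bar>\<omega>\<bar> ^ j * cmod (?V k (Suc l) b x \<omega>) \<le> C2 / (1 + \<bar>x - b\<bar>) ^ N"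
    using Suc.IH by meson
  have "\<bar>\<omega>\<bar> ^ Suc j * cmod (?V k l b x \<omega>) \<le> (C1 + C2) / (1 + \<bar>x - b\<bar>) ^ N" for b x \<omega>
  proof -
    have "\<bar>\<omega>\<bar> ^ Suc j * cmod (?V k l b x \<omega>) = \<bar>\<omega>\<bar> ^ j * cmod (\<i> * of_real \<omega> * ?V k l b x \<omega>)"
      by (simp add: norm_mult)
    also have "\<dots> = \<bar>\<omega>\<bar> ^ j * cmod (?V (Suc k) l b x \<omega> + ?V k (Suc l) b x \<omega>)"
      by (simp only: stft_by_parts[OF assms])
    also have "\<dots> \<le> \<bar>\<omega>\<bar> ^ j * (cmod (?V (Suc k) l b x \<omega>) + cmod (?V k (Suc l) b x \<omega>))"
      by (intro mult_left_mono norm_triangle_ineq) auto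
    also have "\<dots> \<le> (C1 + C2) / (1 + \<bar>x - b\<bar>) ^ N"
      using C1(2)[of \<omega> b x] C2(2)[of \<omega> b x] by (simp add: distrib_left add_divide_distrib)
    finally show ?thesis .
  qed
  with C1 C2 show ?case by (intro exI[of _ "C1 + C2"]) auto
qed

lemma stft_decay:
  assumes "f \<in> schwartz_space" "g \<in> schwartz_space"
  obtains K where "1 \<le> K"
    "\<And>b x \<omega>. cmod (LINT t|lborel. stft_integrand f g 0 0 b x \<omega> t)
        \<le> K / ((1 + \<bar>x - b\<bar>) ^ N * (1 + \<bar>\<omega>\<bar>) ^ N)"
proof -
  let ?V = "\<lambda>b x \<omega>. LINT t|lborel. stft_integrand f g 0 0 b x \<omega> t"
  obtain C0 where C0: "C0 \<ge> 0" "\<And>b x \<omega>. \<bar>\<omega>\<bar> ^ 0 * cmod (?V b x \<omega>) \<le> C0 / (1 + \<bar>x - b\<bar>) ^ N"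
    using stft_moment_bound[OF assms] by meson
  obtain C1 where C1: "C1 \<ge> 0" "\<And>b x \<omega>. \<bar>\<omega>\<bar> ^ N * cmod (?V b x \<omega>) \<le> C1 / (1 + \<bar>x - b\<bar>) ^ N"
    using stft_moment_bound[OF assms] by meson
  show thesis
  proof (rule that[of "1 + 2 ^ N * (C0 + C1)"])
    fix b x \<omega> :: real
    have "cmod (?V b x \<omega>) * (1 + \<bar>\<omega>\<bar>) ^ N \<le> cmod (?V b x \<omega>) * (2 ^ N * (1 + \<bar>\<omega>\<bar> ^ N))"
      by (intro mult_left_mono one_plus_power_le) auto
    also have "\<dots> = 2 ^ N * (\<bar>\<omega>\<bar> ^ 0 * cmod (?V b x \<omega>) + \<bar>\<omega>\<bar> ^ N * cmod (?V b x \<omega>))"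
      by (simp add: algebra_simps)
    also have "\<dots> \<le> 2 ^ N * (C0 / (1 + \<bar>x - b\<bar>) ^ N + C1 / (1 + \<bar>x - b\<bar>) ^ N)"
      by (intro mult_left_mono add_mono C0 C1) auto
    also have "\<dots> \<le> (1 + 2 ^ N * (C0 + C1)) / (1 + \<bar>x - b\<bar>) ^ N"
      by (simp add: add_divide_distrib distrib_left)
    finally show "cmod (?V b x \<omega>) \<le> (1 + 2 ^ N * (C0 + C1)) / ((1 + \<bar>x - b\<bar>) ^ N * (1 + \<bar>\<omega>\<bar>) ^ N)"
      by (simp add: field_simps)
  qed (use C0 C1 in auto)
qed

section \<open>Interference of two coefficients\<close>

text \<open>The map $u \mapsto u^p$ is Lipschitz with constant $p\,(2K)^{p-1} \le 4K$ on $[0, 2K]$, and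
  $|A + B|$ differs from $|A - B|$ by at most twice the smaller modulus, since replacing $A$ or $B$
  by its negative exchanges the two.\<close>
lemma cmod_sum_diff_powr:
  fixes A B :: complex
  assumes "cmod A \<le> K" "cmod B \<le> K" "1 \<le> K" "p \<in> {1..2}"
  shows "\<bar>cmod (A + B) powr p - cmod (A - B) powr p\<bar> \<le> 8 * K * min (cmod A) (cmod B)"
proof -
  have lip: "u powr p - v powr p \<le> 4 * K * (u - v)" if "0 \<le> v" "v < u" "u \<le> 2 * K" for u v
  proof -
    have "\<exists>l z. v < z \<and> z < u \<and> DERIV (\<lambda>x. x powr p) z :> l \<and> u powr p - v powr p = (u - v) * l"
    proof (rule MVT)
      show "continuous_on {v..u} (\<lambda>x. x powr p)"
        using that assms by (auto intro!: continuous_intros continuous_on_powr')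
      show "(\<lambda>x. x powr p) differentiable (at x)" if "v < x" for x
        using that \<open>0 \<le> v\<close> has_real_derivative_powr[of x p]
        by (auto simp: real_differentiable_def)
    qed (use that in auto)
    then obtain l z where z: "v < z" "z < u" "DERIV (\<lambda>x. x powr p) z :> l"
      "u powr p - v powr p = (u - v) * l" by blast
    then have "l = p * z powr (p - 1)"
      using \<open>0 \<le> v\<close> has_real_derivative_powr[of z p] DERIV_unique by fastforce
    also have "\<dots> \<le> 2 * (2 * K)"
    proof (rule mult_mono)
      have "z powr (p - 1) \<le> (2 * K) powr (p - 1)"
        using z that assms by (intro powr_mono2) auto
      also have "\<dots> \<le> (2 * K) powr 1"
        using assms by (intro powr_mono) auto
      finally show "z powr (p - 1) \<le> 2 * K" using assms by simp
    qed (use assms in auto)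
    finally show ?thesis
      using z(4) that mult_left_mono[of l "4 * K" "u - v"] by (simp add: mult_ac)
  qed
  let ?u = "cmod (A + B)" and ?v = "cmod (A - B)"
  have uv: "?u \<le> 2 * K" "?v \<le> 2 * K"
    using assms norm_triangle_ineq[of A B] norm_triangle_ineq4[of A B] by auto
  have "\<bar>?u - ?v\<bar> \<le> 2 * cmod B"
    using norm_triangle_ineq3[of "A + B" "A - B"] by (simp add: norm_mult flip: mult_2)
  moreover have "\<bar>?u - ?v\<bar> \<le> 2 * cmod A"
    using norm_triangle_ineq3[of "A + B" "B - A"] by (simp add: norm_minus_commute norm_mult flip: mult_2)
  ultimately have d: "\<bar>?u - ?v\<bar> \<le> 2 * min (cmod A) (cmod B)"
    by simp
  have "\<bar>?u powr p - ?v powr p\<bar> \<le> 4 * K * \<bar>?u - ?v\<bar>"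
    using lip[of ?v ?u] lip[of ?u ?v] uv powr_mono2[of p ?u ?v] powr_mono2[of p ?v ?u] assms(4)
    by (cases ?u ?v rule: linorder_cases) auto
  also have "\<dots> \<le> 4 * K * (2 * min (cmod A) (cmod B))"
    using d assms by (intro mult_left_mono) auto
  finally show ?thesis by simp
qed

section \<open>Summation over the lattice\<close>

lemma summable_on_int_inverse_square:
  assumes "0 < (c :: real)"
  shows "(\<lambda>n::int. 1 / (1 + \<bar>of_int n * c\<bar>)\<^sup>2) summable_on UNIV"
proof -
  let ?f = "\<lambda>n::int. 1 / (1 + \<bar>of_int n * c\<bar>)\<^sup>2"
  have "summable (\<lambda>n::nat. 1 / (1 + real n * c)\<^sup>2)"
  proof (rule summable_comparison_test')
    show "summable (\<lambda>n. 1 / c\<^sup>2 * inverse (real n ^ 2))"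
      by (intro summable_mult inverse_power_summable) auto
    show "norm (1 / (1 + real n * c)\<^sup>2) \<le> 1 / c\<^sup>2 * inverse (real n ^ 2)" if "n \<ge> 1" for n
    proof -
      have "(real n * c)\<^sup>2 \<le> (1 + real n * c)\<^sup>2"
        using assms by (intro power_mono) auto
      then have "1 / (1 + real n * c)\<^sup>2 \<le> 1 / (real n * c)\<^sup>2"
        using assms that by (intro divide_left_mono mult_pos_pos zero_less_power) (auto intro: add_pos_nonneg)
      then show ?thesis by (simp add: field_simps power_mult_distrib)
    qed
  qed
  then have *: "(\<lambda>n::nat. 1 / (1 + real n * c)\<^sup>2) summable_on UNIV"
    by (subst summable_on_UNIV_nonneg_real_iff) auto
  have "?f summable_on range int" "?f summable_on range (\<lambda>n. - int n)"
    using * assms by (auto simp: summable_on_reindex inj_on_def o_def abs_mult)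
  then have "?f summable_on (range int \<union> range (\<lambda>n. - int n))"
    by (rule summable_on_union)
  also have "range int \<union> range (\<lambda>n. - int n) = UNIV"
    by (auto intro: int_cases2)
  finally show ?thesis .
qed

lemma summable_on_lattice_inverse_square:
  assumes "0 < (c :: real)" "0 < (d :: real)"
  shows "(\<lambda>(n::int, k::int). 1 / ((1 + \<bar>of_int n * c\<bar>)\<^sup>2 * (1 + \<bar>of_int k * d\<bar>)\<^sup>2)) summable_on UNIV"
proof -
  let ?g = "\<lambda>(c::real) n::int. 1 / (1 + \<bar>of_int n * c\<bar>)\<^sup>2"
  have "(\<lambda>(n, k). ?g c n * ?g d k) summable_on (SIGMA n:UNIV. UNIV)"
  proof (rule summable_on_SigmaI)
    show "((\<lambda>k. case (n, k) of (n, k) \<Rightarrow> ?g c n * ?g d k) has_sum ?g c n * infsum (?g d) UNIV) UNIV" for n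
      unfolding prod.case
      by (rule has_sum_cmult_right[OF has_sum_infsum[OF summable_on_int_inverse_square[OF assms(2)]]])
    show "(\<lambda>n. ?g c n * infsum (?g d) UNIV) summable_on UNIV"
      by (rule summable_on_cmult_left[OF summable_on_int_inverse_square[OF assms(1)]])
  qed auto
  then show ?thesis by (simp add: case_prod_unfold)
qed

lemma powr_div_power_le:
  fixes X :: real
  assumes "1 \<le> X" "r \<le> real N - 2"
  shows "X powr r / X ^ N \<le> 1 / X\<^sup>2"
proof -
  have "X powr r / X ^ N = X powr (r - real N)"
    using assms by (simp add: powr_diff powr_realpow)
  also have "\<dots> \<le> X powr - 2"
    using assms by (intro powr_mono) auto
  also have "\<dots> = 1 / X\<^sup>2"
    using assms by (simp add: powr_minus_divide)
  finally show ?thesis .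
qed

section \<open>The Gabor coefficients of the two Gaussian bumps\<close>

lemma gabor_coefficient_eq:
  "L2_inner (\<lambda>t. f (t - b)) (gabor_atom x0 y0 g n k)
     = (LINT t|lborel. stft_integrand f g 0 0 b (of_int n * x0) (2 * pi * (of_int k * y0)) t)"
  "f (t - b) * cnj (gabor_atom x0 y0 g n k t)
     = stft_integrand f g 0 0 b (of_int n * x0) (2 * pi * (of_int k * y0)) t"
proof -
  show *: "f (t - b) * cnj (gabor_atom x0 y0 g n k t)
     = stft_integrand f g 0 0 b (of_int n * x0) (2 * pi * (of_int k * y0)) t" for t
    by (simp add: gabor_atom_def stft_integrand_def higher_vderiv_def exp_cnj mult_ac)
  show "L2_inner (\<lambda>t. f (t - b)) (gabor_atom x0 y0 g n k)
     = (LINT t|lborel. stft_integrand f g 0 0 b (of_int n * x0) (2 * pi * (of_int k * y0)) t)"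
    unfolding L2_inner_def by (simp add: *)
qed

definition gaussian_coeff ::
  "real \<Rightarrow> real \<Rightarrow> (real \<Rightarrow> complex) \<Rightarrow> real \<Rightarrow> int \<Rightarrow> int \<Rightarrow> complex"
where
  "gaussian_coeff x0 y0 g b n k = L2_inner (\<lambda>t. gaussian (t - b)) (gabor_atom x0 y0 g n k)"

lemma gaussian_coeff_decay:
  assumes "g \<in> schwartz_space"
  obtains K where "1 \<le> K" "\<And>b n k. cmod (gaussian_coeff x0 y0 g b n k)
    \<le> K / ((1 + \<bar>of_int n * x0 - b\<bar>) ^ N * (1 + \<bar>of_int k * y0\<bar>) ^ N)"
proof -
  obtain K where K: "1 \<le> K" "\<And>b x \<omega>. cmod (LINT t|lborel. stft_integrand gaussian g 0 0 b x \<omega> t)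
        \<le> K / ((1 + \<bar>x - b\<bar>) ^ N * (1 + \<bar>\<omega>\<bar>) ^ N)"
    using stft_decay[OF gaussian_schwartz assms] by blast
  have "cmod (gaussian_coeff x0 y0 g b n k)
    \<le> K / ((1 + \<bar>of_int n * x0 - b\<bar>) ^ N * (1 + \<bar>of_int k * y0\<bar>) ^ N)" for b n k
  proof -
    have "\<bar>of_int k * y0\<bar> \<le> \<bar>2 * pi * (of_int k * y0)\<bar>"
      using mult_right_mono[of 1 "2 * pi" "\<bar>of_int k * y0\<bar>"] pi_ge_two by (simp add: abs_mult)
    then have "K / ((1 + \<bar>of_int n * x0 - b\<bar>) ^ N * (1 + \<bar>2 * pi * (of_int k * y0)\<bar>) ^ N)
       \<le> K / ((1 + \<bar>of_int n * x0 - b\<bar>) ^ N * (1 + \<bar>of_int k * y0\<bar>) ^ N)"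
      using K(1) by (intro divide_left_mono mult_left_mono power_mono)
        (auto intro!: mult_pos_pos zero_less_power add_pos_nonneg)
    with K(2) show ?thesis
      unfolding gaussian_coeff_def gabor_coefficient_eq by (rule order.trans)
  qed
  with K(1) show thesis by (rule that)
qed

lemma L2_inner_f_plus_minus:
  assumes "g \<in> schwartz_space"
  shows "L2_inner (f_plus a) (gabor_atom x0 y0 g n k) = gaussian_coeff x0 y0 g (- a) n k + gaussian_coeff x0 y0 g a n k"
    and "L2_inner (f_minus a) (gabor_atom x0 y0 g n k) = gaussian_coeff x0 y0 g (- a) n k - gaussian_coeff x0 y0 g a n k"
proof -
  have int: "integrable lborel (\<lambda>t. gaussian (t - b) * cnj (gabor_atom x0 y0 g n k t))" for b
    unfolding gabor_coefficient_eq(2) by (rule stft_integrable[OF gaussian_schwartz assms])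
  show "L2_inner (f_plus a) (gabor_atom x0 y0 g n k) = gaussian_coeff x0 y0 g (- a) n k + gaussian_coeff x0 y0 g a n k"
    "L2_inner (f_minus a) (gabor_atom x0 y0 g n k) = gaussian_coeff x0 y0 g (- a) n k - gaussian_coeff x0 y0 g a n k"
    using int[of a] int[of "- a"]
    by (simp_all add: gaussian_coeff_def L2_inner_def f_plus_def f_minus_def distrib_right left_diff_distrib)
qed

lemma gabor_term_eq:
  "gabor_term x0 y0 g s p f (n, k) = cmod (L2_inner f (gabor_atom x0 y0 g n k)) powr p *
     ((1 + \<bar>of_int n * x0\<bar>) powr (s * p) * (1 + \<bar>of_int k * y0\<bar>) powr (s * p))"
  by (simp add: gabor_term_def weight_def powr_powr powr_mult)

section \<open>Estimates for the weighted terms\<close>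

text \<open>As $p \ge 1$, raising to the power $p$ does not spoil decay of order $N$, and two orders
  beyond the weight suffice for summability.\<close>
lemma gabor_term_summable:
  assumes pos: "0 < x0" "0 < y0" and p: "p \<in> {1..2}" and r: "s * p \<le> real N - 2"
    and L: "1 \<le> L" "\<And>n k. cmod (L2_inner f (gabor_atom x0 y0 g n k))
              \<le> L / ((1 + \<bar>of_int n * x0\<bar>) ^ N * (1 + \<bar>of_int k * y0\<bar>) ^ N)"
  shows "gabor_term x0 y0 g s p f summable_on UNIV"
proof (rule summable_on_comparison_test)
  show "(\<lambda>z. L\<^sup>2 * (case z of (n::int, k::int) \<Rightarrow> 1 / ((1 + \<bar>of_int n * x0\<bar>)\<^sup>2 * (1 + \<bar>of_int k * y0\<bar>)\<^sup>2))) summable_on UNIV"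
    by (rule summable_on_cmult_right[OF summable_on_lattice_inverse_square[OF pos]])
  fix z :: "int \<times> int"
  obtain n k where z: "z = (n, k)" by (cases z)
  define X where "X = 1 + \<bar>of_int n * x0\<bar>"
  define Y where "Y = 1 + \<bar>of_int k * y0\<bar>"
  have XY: "1 \<le> X" "1 \<le> Y" by (auto simp: X_def Y_def)
  define D where "D = X ^ N * Y ^ N"
  have D: "1 \<le> D"
    using XY mult_mono[of 1 "X ^ N" 1 "Y ^ N"] by (simp add: D_def one_le_power)
  have "cmod (L2_inner f (gabor_atom x0 y0 g n k)) powr p \<le> (L / D) powr p"
    using L(2)[of n k] p by (intro powr_mono2) (auto simp: X_def Y_def D_def)
  also have "\<dots> = L powr p / D powr p"
    using L D by (simp add: powr_divide)
  also have "\<dots> \<le> L powr 2 / D powr 1"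
    using L D p by (intro frac_le powr_mono) auto
  also have "\<dots> = L\<^sup>2 / D" using L D by simp
  finally have c: "cmod (L2_inner f (gabor_atom x0 y0 g n k)) powr p \<le> L\<^sup>2 / D" .
  have "gabor_term x0 y0 g s p f z \<le> L\<^sup>2 / D * (X powr (s * p) * Y powr (s * p))"
    unfolding z gabor_term_eq X_def [symmetric] Y_def [symmetric] using c by (intro mult_right_mono) auto
  also have "\<dots> = L\<^sup>2 * (X powr (s * p) / X ^ N * (Y powr (s * p) / Y ^ N))"
    by (simp add: D_def)
  also have "\<dots> \<le> L\<^sup>2 * (1 / X\<^sup>2 * (1 / Y\<^sup>2))"
    using XY r by (intro mult_left_mono mult_mono powr_div_power_le) auto
  finally show "gabor_term x0 y0 g s p f z \<le> L\<^sup>2 * (case z of (n::int, k::int) \<Rightarrow> 1 / ((1 + \<bar>of_int n * x0\<bar>)\<^sup>2 * (1 + \<bar>of_int k * y0\<bar>)\<^sup>2))"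
    by (simp add: z X_def Y_def)
  show "0 \<le> gabor_term x0 y0 g s p f z"
    by (simp add: z gabor_term_eq)
qed

text \<open>For a fixed bump, decay away from its centre is decay away from the origin, with a constant
  that grows with $b$. This serves summability only, where that growth is harmless.\<close>
lemma gaussian_coeff_decay_at_origin:
  assumes K: "1 \<le> K" "\<And>b n k. cmod (gaussian_coeff x0 y0 g b n k)
    \<le> K / ((1 + \<bar>of_int n * x0 - b\<bar>) ^ N * (1 + \<bar>of_int k * y0\<bar>) ^ N)"
  shows "cmod (gaussian_coeff x0 y0 g b n k)
    \<le> K * (1 + \<bar>b\<bar>) ^ N / ((1 + \<bar>of_int n * x0\<bar>) ^ N * (1 + \<bar>of_int k * y0\<bar>) ^ N)"
proof -
  let ?x = "of_int n * x0 :: real"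
  have "1 + \<bar>?x\<bar> \<le> (1 + \<bar>?x - b\<bar>) * (1 + \<bar>b\<bar>)"
    using one_plus_abs_add_le[of "?x - b" b] by simp
  then have "(1 + \<bar>?x\<bar>) ^ N \<le> ((1 + \<bar>?x - b\<bar>) * (1 + \<bar>b\<bar>)) ^ N"
    by (rule power_mono) auto
  then have "1 / (1 + \<bar>?x - b\<bar>) ^ N \<le> (1 + \<bar>b\<bar>) ^ N / (1 + \<bar>?x\<bar>) ^ N"
    by (simp add: power_mult_distrib pos_divide_le_eq pos_le_divide_eq add_pos_nonneg mult.commute)
  then have "K / (1 + \<bar>of_int k * y0\<bar>) ^ N * (1 / (1 + \<bar>?x - b\<bar>) ^ N)
      \<le> K / (1 + \<bar>of_int k * y0\<bar>) ^ N * ((1 + \<bar>b\<bar>) ^ N / (1 + \<bar>?x\<bar>) ^ N)"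
    using K(1) by (intro mult_left_mono) auto
  then show ?thesis
    using K(2)[of b n k] by (simp add: mult_ac)
qed

text \<open>The interference at one lattice point is governed by the farther bump: it is the one at $-a$
  if $x \ge 0$ and the one at $a$ otherwise, at distance $|x| + a$.\<close>
lemma gabor_term_diff_le:
  assumes g: "g \<in> schwartz_space" and p: "p \<in> {1..2}" and s: "0 \<le> s" 
    and m: "s * p + 1 < real m" and a: "0 < a"
    and K: "1 \<le> K" "\<And>b n k. cmod (gaussian_coeff x0 y0 g b n k)
    \<le> K / ((1 + \<bar>of_int n * x0 - b\<bar>) ^ (m + 1) * (1 + \<bar>of_int k * y0\<bar>) ^ (m + 1))"
  shows "\<bar>gabor_term x0 y0 g s p (f_plus a) (n, k) - gabor_term x0 y0 g s p (f_minus a) (n, k)\<bar>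
     \<le> 8 * K\<^sup>2 * (1 + a) powr (s * p - real m + 1) *
         (1 / ((1 + \<bar>of_int n * x0\<bar>)\<^sup>2 * (1 + \<bar>of_int k * y0\<bar>)\<^sup>2))"
proof -
  define r N where "r = s * p" and "N = m + 1"
  have r: "0 \<le> r" "r < real m - 1" using s p m by (auto simp: r_def)
  define x where "x = of_int n * x0"
  define X where "X = 1 + \<bar>x\<bar>"
  define Y where "Y = 1 + \<bar>of_int k * y0\<bar>"
  have XY: "1 \<le> X" "1 \<le> Y" by (auto simp: X_def Y_def)
  \<comment> \<open>one plus the distance from \<open>x\<close> to the farther bump\<close>
  define U where "U = X + a"
  have U: "1 \<le> U" "X \<le> U" "1 + a \<le> U" using XY a by (auto simp: U_def)
  let ?A = "gaussian_coeff x0 y0 g (- a) n k" and ?B = "gaussian_coeff x0 y0 g a n k"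
  have le_K: "cmod (gaussian_coeff x0 y0 g b n k) \<le> K" for b
  proof -
    have "1 * 1 \<le> (1 + \<bar>x - b\<bar>) ^ N * Y ^ N"
      using XY by (intro mult_mono one_le_power) auto
    then have "K / ((1 + \<bar>x - b\<bar>) ^ N * Y ^ N) \<le> K / 1"
      using K(1) by (intro divide_left_mono) auto
    with K(2)[of b n k] show ?thesis by (simp add: x_def Y_def N_def)
  qed
  have far: "min (cmod ?A) (cmod ?B) \<le> K / (U ^ N * Y ^ N)"
  proof (cases "0 \<le> x")
    case True
    then have "1 + \<bar>x - (- a)\<bar> = U" using a by (simp add: U_def X_def)
    then show ?thesis using K(2)[of "- a" n k] by (simp add: x_def Y_def N_def min.coboundedI1)
  next
    case False
    then have "1 + \<bar>x - a\<bar> = U" using a by (simp add: U_def X_def)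
    then show ?thesis using K(2)[of a n k] by (simp add: x_def Y_def N_def min.coboundedI2)
  qed
  have "X powr r / U ^ N \<le> U powr r / U ^ N"
    using XY U r by (intro divide_right_mono powr_mono2) auto
  \<comment> \<open>the exponent \<open>m + 1\<close> splits into the claimed rate and the two orders needed to sum\<close>
  also have "\<dots> = U powr (r - real m + 1) / U\<^sup>2"
    using U by (simp add: N_def powr_diff powr_add powr_realpow power2_eq_square field_simps)
  also have "\<dots> \<le> (1 + a) powr (r - real m + 1) / X\<^sup>2"
    using U XY a r by (intro frac_le powr_mono2' power_mono) auto
  finally have x_part: "X powr r / U ^ N \<le> (1 + a) powr (r - real m + 1) / X\<^sup>2" .
  have y_part: "Y powr r / Y ^ N \<le> 1 / Y\<^sup>2"
    using XY r by (intro powr_div_power_le) (auto simp: N_def)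
  have "\<bar>cmod (?A + ?B) powr p - cmod (?A - ?B) powr p\<bar> \<le> 8 * K * min (cmod ?A) (cmod ?B)"
    using le_K K p by (intro cmod_sum_diff_powr) auto
  also have "\<dots> \<le> 8 * K * (K / (U ^ N * Y ^ N))"
    using far K(1) by (intro mult_left_mono) auto
  finally have "\<bar>cmod (?A + ?B) powr p - cmod (?A - ?B) powr p\<bar> * (X powr r * Y powr r)
      \<le> 8 * K * (K / (U ^ N * Y ^ N)) * (X powr r * Y powr r)"
    by (intro mult_right_mono) auto
  also have "\<dots> = 8 * K\<^sup>2 * (X powr r / U ^ N * (Y powr r / Y ^ N))"
    by (simp add: power2_eq_square)
  also have "\<dots> \<le> 8 * K\<^sup>2 * ((1 + a) powr (r - real m + 1) / X\<^sup>2 * (1 / Y\<^sup>2))"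
    using x_part y_part U XY by (intro mult_left_mono mult_mono) auto
  finally show ?thesis
    unfolding gabor_term_eq L2_inner_f_plus_minus[OF g]
    by (simp add: X_def Y_def x_def r_def abs_mult flip: left_diff_distrib)
qed

section \<open>The main estimate\<close>

theorem proposition3p6:
  fixes g :: "real \<Rightarrow> complex" and x0 y0 :: real and m :: nat
  assumes "g \<in> schwartz_space" and "g \<noteq> (\<lambda>t. 0)"
    and "x0 > 0" and "y0 > 0"
  shows "\<exists>C>0. \<forall>(s::real) (p::real) (a::real).
           s \<ge> 0 \<longrightarrow> p \<in> {1..2} \<longrightarrow> real m > s * p + 1 \<longrightarrow> a > 0 \<longrightarrow>
             gabor_term x0 y0 g s p (f_plus a) summable_on UNIV \<and>
             gabor_term x0 y0 g s p (f_minus a) summable_on UNIV \<and>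
             \<bar>gabor_norm_pow x0 y0 g s p (f_plus a) - gabor_norm_pow x0 y0 g s p (f_minus a)\<bar>
               \<le> C * (1 + a) powr (s * p - real m + 1)"
proof -
  obtain K where K: "1 \<le> K" "\<And>b n k. cmod (gaussian_coeff x0 y0 g b n k)
    \<le> K / ((1 + \<bar>of_int n * x0 - b\<bar>) ^ (m + 1) * (1 + \<bar>of_int k * y0\<bar>) ^ (m + 1))"
    using gaussian_coeff_decay[OF assms(1)] by blast
  define q where "q = (\<lambda>(n::int, k::int). 1 / ((1 + \<bar>of_int n * x0\<bar>)\<^sup>2 * (1 + \<bar>of_int k * y0\<bar>)\<^sup>2))"
  have q: "q summable_on UNIV"
    unfolding q_def by (rule summable_on_lattice_inverse_square[OF assms(3,4)])
  define S where "S = infsum q UNIV"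
  have "0 \<le> S" unfolding S_def by (rule infsum_nonneg) (auto simp: q_def)
  \<comment> \<open>the summand \<open>1\<close> only serves strict positivity\<close>
  then have C: "0 < 8 * K\<^sup>2 * S + 1"
    by (simp add: add_nonneg_pos)
  show ?thesis
  proof (intro exI[of _ "8 * K\<^sup>2 * S + 1"] conjI allI impI C)
    fix s p a :: real
    assume s: "s \<ge> 0" and p: "p \<in> {1..2}" and m: "real m > s * p + 1" and a: "a > 0"
    let ?T = "gabor_term x0 y0 g s p"
    have L: "1 \<le> 2 * K * (1 + a) ^ (m + 1)"
      using K(1) a one_le_power[of "1 + a" "m + 1"] mult_mono[of 1 "2 * K" 1 "(1 + a) ^ (m + 1)"] by simp
    have r: "s * p \<le> real (m + 1) - 2" using m by simp
    note bd = gaussian_coeff_decay_at_origin[OF K]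
    show sp: "?T (f_plus a) summable_on UNIV"
    proof (rule gabor_term_summable[OF assms(3,4) p r L])
      fix n k
      show "cmod (L2_inner (f_plus a) (gabor_atom x0 y0 g n k))
        \<le> 2 * K * (1 + a) ^ (m + 1) / ((1 + \<bar>of_int n * x0\<bar>) ^ (m + 1) * (1 + \<bar>of_int k * y0\<bar>) ^ (m + 1))"
        unfolding L2_inner_f_plus_minus[OF assms(1)]
        using norm_triangle_mono[OF bd[of "- a" n k] bd[of a n k]] a by (simp add: mult_ac)
    qed
    show sm: "?T (f_minus a) summable_on UNIV"
    proof (rule gabor_term_summable[OF assms(3,4) p r L])
      fix n k
      show "cmod (L2_inner (f_minus a) (gabor_atom x0 y0 g n k))
        \<le> 2 * K * (1 + a) ^ (m + 1) / ((1 + \<bar>of_int n * x0\<bar>) ^ (m + 1) * (1 + \<bar>of_int k * y0\<bar>) ^ (m + 1))"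
        unfolding L2_inner_f_plus_minus[OF assms(1)]
        using norm_triangle_le_diff[OF add_mono[OF bd[of "- a" n k] bd[of a n k]]] a by (simp add: mult_ac)
    qed
    let ?E = "(1 + a) powr (s * p - real m + 1)"
    have le: "\<bar>?T (f_plus a) z - ?T (f_minus a) z\<bar> \<le> 8 * K\<^sup>2 * ?E * q z" for z
      using gabor_term_diff_le[OF assms(1) p s m a K] by (cases z) (simp add: q_def)
    have dom: "(\<lambda>z. 8 * K\<^sup>2 * ?E * q z) summable_on UNIV"
      by (rule summable_on_cmult_right[OF q])
    have abs: "(\<lambda>z. norm (?T (f_plus a) z - ?T (f_minus a) z)) summable_on UNIV"
      by (rule summable_on_comparison_test[OF dom]) (use le in auto)
    have "\<bar>gabor_norm_pow x0 y0 g s p (f_plus a) - gabor_norm_pow x0 y0 g s p (f_minus a)\<bar>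
       = \<bar>\<Sum>\<^sub>\<infinity>z\<in>UNIV. ?T (f_plus a) z - ?T (f_minus a) z\<bar>"
      unfolding gabor_norm_pow_def
      using infsum_add[OF sp summable_on_uminus[THEN iffD2, OF sm]] by (simp add: infsum_uminus)
    also have "\<dots> \<le> (\<Sum>\<^sub>\<infinity>z\<in>UNIV. \<bar>?T (f_plus a) z - ?T (f_minus a) z\<bar>)"
      using norm_infsum_bound[OF abs] by simp
    also have "\<dots> \<le> (\<Sum>\<^sub>\<infinity>z\<in>UNIV. 8 * K\<^sup>2 * ?E * q z)"
      using abs dom le by (intro infsum_mono) auto
    also have "\<dots> = 8 * K\<^sup>2 * ?E * S"
      unfolding S_def by (rule infsum_cmult_right')
    also have "\<dots> \<le> (8 * K\<^sup>2 * S + 1) * ?E"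
      by (simp add: algebra_simps)
    finally show "\<bar>gabor_norm_pow x0 y0 g s p (f_plus a) - gabor_norm_pow x0 y0 g s p (f_minus a)\<bar>
       \<le> (8 * K\<^sup>2 * S + 1) * ?E" .
  qed
qed
end
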